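(* Let $\Delta:\mathbb{N}^{(2)}\to[k]$ be surjective and suppose $n$ is a natural number such that $k\geq\binom{n}{2}+1$. Then there exists an $n$-homogeneous tuple with respect to $\Delta$.
   Context: For a set $X$, $X^{(2)}$ denotes the set of unordered pairs of elements of $X$, and $[k]=\{1,\dots,k\}$. A set $X\subset\mathbb{N}$ is $m$-coloured if $\Delta(X^{(2)})$ has exactly $m$ elements. For $v\in\mathbb{N}$ and $X\subset\mathbb{N}\setminus\{v\}$, a colour $c$ is a new colour from $v$ into $X$ if some edge from $v$ to a vertex of $X$ has colour $c$ and no edge in $X^{(2)}$ has colour $c$; $N_{\Delta}(v,X)$ denotes the set of new colours from $v$ into $X$. For an $n$-tuple $\mathbf{X}=(X_1,\dots,X_n)$ write $\bar{X}_i=X_1\cup\dots\cup X_i$. The tuple $\mathbf{X}$, with each $X_i$ a nonempty subset of $\mathbb{N}$, is $n$-homogeneous with respect to $\Delta$ if: (1) $X_i\cap X_j=\emptyset$ for $i\neq j$; (2) $X_1$ is infinite and $1$-coloured; (3) $\Delta(\bar{X}_1^{(2)})\subsetneq\Delta(\bar{X}_2^{(2)})\subsetneq\dots\subsetneq\Delta(\bar{X}_n^{(2)})$; (4) for each $2\leq i\leq n$ and every $v\in X_i$, $N_{\Delta}(v,\bar{X}_{i-1})=\Delta(\bar{X}_i^{(2)})\setminus\Delta(\bar{X}_{i-1}^{(2)})$; (5) $|\Delta(\bar{X}_n^{(2)})|\leq\binom{n}{2}+1$. *)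

theory Defs
  imports "HOL-Library.Ramsey"
begin

text \<open>
  The set of unordered pairs of (distinct) elements of X is \<^term>\<open>nsets X 2\<close>. A colouring of
  the edges of the complete graph on \<^typ>\<open>nat\<close> is a function on sets of naturals of which only
  the values on \<^term>\<open>nsets (UNIV :: nat set) 2\<close> matter.
\<close>

definition colours :: "(nat set \<Rightarrow> nat) \<Rightarrow> nat set \<Rightarrow> nat set" where
  "colours \<Delta> X = \<Delta> ` nsets X 2"

definition coloured :: "(nat set \<Rightarrow> nat) \<Rightarrow> nat \<Rightarrow> nat set \<Rightarrow> bool" where
  "coloured \<Delta> m X \<longleftrightarrow> finite (colours \<Delta> X) \<and> card (colours \<Delta> X) = m"

text \<open>
  The new colours from v into X. The notion is meant for v outside X only; otherwise
  \<^term>\<open>{v, x}\<close> might be a singleton.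
\<close>

definition new_colours :: "(nat set \<Rightarrow> nat) \<Rightarrow> nat \<Rightarrow> nat set \<Rightarrow> nat set" where
  "new_colours \<Delta> v X = {c. (\<exists>x\<in>X. \<Delta> {v, x} = c) \<and> c \<notin> colours \<Delta> X}"

text \<open>
  An n-tuple of sets is a function whose values at 1, ..., n are the components; values at other
  arguments are never used.
\<close>

definition initial_union :: "(nat \<Rightarrow> nat set) \<Rightarrow> nat \<Rightarrow> nat set" where
  "initial_union X i = (\<Union>j\<in>{1..i}. X j)"

text \<open>
  In the last clause finiteness is stated separately because \<^const>\<open>card\<close> of an infinite set
  is 0. In the fourth clause v lies outside the initial union by disjointness.
\<close>

definition homogeneous_tuple :: "(nat set \<Rightarrow> nat) \<Rightarrow> nat \<Rightarrow> (nat \<Rightarrow> nat set) \<Rightarrow> bool" where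
  "homogeneous_tuple \<Delta> n X \<longleftrightarrow>
     (\<forall>i\<in>{1..n}. X i \<noteq> {}) \<and>
     (\<forall>i\<in>{1..n}. \<forall>j\<in>{1..n}. i \<noteq> j \<longrightarrow> X i \<inter> X j = {}) \<and>
     (infinite (X 1) \<and> coloured \<Delta> 1 (X 1)) \<and>
     (\<forall>i\<in>{1..<n}. colours \<Delta> (initial_union X i) \<subset> colours \<Delta> (initial_union X (i + 1))) \<and>
     (\<forall>i\<in>{2..n}. \<forall>v\<in>X i. new_colours \<Delta> v (initial_union X (i - 1)) =
        colours \<Delta> (initial_union X i) - colours \<Delta> (initial_union X (i - 1))) \<and>
     (finite (colours \<Delta> (initial_union X n)) \<and>
      card (colours \<Delta> (initial_union X n)) \<le> (n choose 2) + 1)"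

end

theory Submission
  imports Defs
begin

text \<open>
  Fix a finite set F of vertices spanning all the colours and an infinite 1-coloured set A such that
  all edges from a given vertex of F to A have the same colour; everything then happens inside
  the union of A and F. Argue by induction on n. To pass from n to n + 1, shrink F until no vertex of F can
  be removed without falling below the required number of colours. For v in F, take an n-homogeneous
  tuple in the rest and add the remaining vertices other than v one at a time: each of them can be
  absorbed without changing the set of colours, or produces a further level, and in that case the
  colour bound holds by minimality of F. If all are absorbed for every v, the bound on the
  number of colours of the tuple shows that each v has at least n private colours, lying only
  on edges at v. Then the star formed by v and the ends of n such edges gives the n + 1 levels on so
  few vertices that the colour bound is automatic.
\<close>

section \<open>Colours of sets and of one-vertex extensions\<close>

lemma colours_mono: "X \<subseteq> Y \<Longrightarrow> colours \<Delta> X \<subseteq> colours \<Delta> Y"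
  unfolding colours_def by (intro image_mono nsets_mono)

lemma colours_iff: "c \<in> colours \<Delta> X \<longleftrightarrow> (\<exists>x\<in>X. \<exists>y\<in>X. x \<noteq> y \<and> c = \<Delta> {x, y})"
proof
  assume "c \<in> colours \<Delta> X"
  then show "\<exists>x\<in>X. \<exists>y\<in>X. x \<noteq> y \<and> c = \<Delta> {x, y}"
    unfolding colours_def nsets_def by (auto simp: card_2_iff)
next
  assume "\<exists>x\<in>X. \<exists>y\<in>X. x \<noteq> y \<and> c = \<Delta> {x, y}"
  then show "c \<in> colours \<Delta> X"
    unfolding colours_def nsets_def by (force simp: card_2_iff)
qed

lemma edge_in_colours: "x \<in> X \<Longrightarrow> y \<in> X \<Longrightarrow> x \<noteq> y \<Longrightarrow> \<Delta> {x, y} \<in> colours \<Delta> X"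
  unfolding colours_iff by blast

lemma new_colours_eq: "new_colours \<Delta> v X = (\<lambda>x. \<Delta> {v, x}) ` X - colours \<Delta> X"
  unfolding new_colours_def by blast

lemma colours_insert: "colours \<Delta> (insert u B) = colours \<Delta> B \<union> (\<lambda>x. \<Delta> {u, x}) ` (B - {u})"
  by (rule set_eqI) (auto simp: colours_iff insert_commute)

lemma colours_insert_new:
  "u \<notin> B \<Longrightarrow> colours \<Delta> (insert u B) = colours \<Delta> B \<union> new_colours \<Delta> u B"
  by (auto simp: colours_insert new_colours_eq)

section \<open>Homogeneous unions and adding vertices to them\<close>

text \<open>The union of an n-tuple satisfying all clauses of homogeneity except the last one.\<close>

inductive homogeneous_union :: "(nat set \<Rightarrow> nat) \<Rightarrow> nat \<Rightarrow> nat set \<Rightarrow> bool" for \<Delta> where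
  one: "infinite B \<Longrightarrow> coloured \<Delta> 1 B \<Longrightarrow> homogeneous_union \<Delta> 1 B"
| step: "homogeneous_union \<Delta> n B \<Longrightarrow> B \<subseteq> C \<Longrightarrow> colours \<Delta> B \<subset> colours \<Delta> C \<Longrightarrow>
    (\<And>v. v \<in> C - B \<Longrightarrow> new_colours \<Delta> v B = colours \<Delta> C - colours \<Delta> B) \<Longrightarrow>
    homogeneous_union \<Delta> (Suc n) C"

lemma homogeneous_union_extend:
  assumes "homogeneous_union \<Delta> n B" "u \<notin> B" "new_colours \<Delta> u B \<noteq> {}"
  shows "homogeneous_union \<Delta> (Suc n) (insert u B)"
proof (rule step[OF assms(1)])
  show "colours \<Delta> B \<subset> colours \<Delta> (insert u B)"
    using assms by (auto simp: colours_insert_new new_colours_def)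
  show "new_colours \<Delta> v B = colours \<Delta> (insert u B) - colours \<Delta> B" if "v \<in> insert u B - B" for v
    using that assms by (auto simp: colours_insert_new new_colours_def)
qed auto

text \<open>A vertex without new colours goes into the level just above the largest initial union into
  which it does have new colours. If it sees only some of the colours introduced by that level, it
  forms a level of its own below it.\<close>

lemma homogeneous_union_absorb:
  assumes "homogeneous_union \<Delta> n B" "u \<notin> B" "new_colours \<Delta> u B = {}"
  shows "homogeneous_union \<Delta> n (insert u B) \<or> homogeneous_union \<Delta> (Suc n) (insert u B)"
  using assms
proof (induction rule: homogeneous_union.induct)
  case (one B)
  then have "homogeneous_union \<Delta> 1 (insert u B)"
    by (intro homogeneous_union.one) (auto simp: coloured_def colours_insert_new)
  then show ?case by blast
next
  case (step n B C)
  have u: "u \<notin> B" and uC: "u \<notin> C" using step by auto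
  have eC: "colours \<Delta> (insert u C) = colours \<Delta> C" using step uC by (simp add: colours_insert_new)
  have eB: "colours \<Delta> (insert u B) = colours \<Delta> B \<union> new_colours \<Delta> u B"
    using u by (rule colours_insert_new)
  have nB: "new_colours \<Delta> u B \<subseteq> colours \<Delta> C - colours \<Delta> B"
    using step.prems step.hyps(2) by (auto simp: new_colours_eq)
  have uv: "\<Delta> {v, u} \<in> colours \<Delta> C" if "v \<in> C" for v
    using step.prems that by (auto simp: new_colours_eq insert_commute)
  \<comment> \<open>The vertices of \<open>C\<close> other than \<open>u\<close> outside
    \<open>B\<close> form the level above \<open>insert u B\<close>. Relative to \<open>B\<close>
    they already see all the colours of the old level; the extra edge to \<open>u\<close> can only
    contribute a colour of \<open>C\<close>. The number \<open>m\<close> is left open because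
    \<open>u\<close> may or may not have created a level below.\<close>
  have above: "homogeneous_union \<Delta> (Suc m) (insert u C)"
    if "homogeneous_union \<Delta> m (insert u B)" "colours \<Delta> (insert u B) \<noteq> colours \<Delta> C" for m
  proof (rule homogeneous_union.step[OF that(1)])
    show "insert u B \<subseteq> insert u C" using step.hyps by blast
    show "colours \<Delta> (insert u B) \<subset> colours \<Delta> (insert u C)"
      using that(2) nB step.hyps(3) unfolding eC eB by blast
    show "new_colours \<Delta> v (insert u B) = colours \<Delta> (insert u C) - colours \<Delta> (insert u B)"
      if v: "v \<in> insert u C - insert u B" for v
    proof -
      have "new_colours \<Delta> v B = colours \<Delta> C - colours \<Delta> B" "\<Delta> {v, u} \<in> colours \<Delta> C"
        using v step.hyps(4) uv by auto
      moreover have "new_colours \<Delta> v (insert u B) =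
          insert (\<Delta> {v, u}) (new_colours \<Delta> v B) - colours \<Delta> (insert u B)"
        unfolding new_colours_eq eB by auto
      ultimately show ?thesis unfolding eC eB by auto
    qed
  qed
  consider "new_colours \<Delta> u B = {}" | "new_colours \<Delta> u B = colours \<Delta> C - colours \<Delta> B"
    | "new_colours \<Delta> u B \<noteq> {}" "new_colours \<Delta> u B \<noteq> colours \<Delta> C - colours \<Delta> B" by blast
  then show ?case
  proof cases
    case 1
    then show ?thesis using step.IH[OF u 1] above step.hyps(3) eB by auto
  next
    case 2
    have "homogeneous_union \<Delta> (Suc n) (insert u C)"
      by (rule homogeneous_union.step[OF step.hyps(1)]) (use step.hyps 2 in \<open>auto simp: eC\<close>)
    then show ?thesis by blast
  next
    case 3
    have "homogeneous_union \<Delta> (Suc n) (insert u B)"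
      using homogeneous_union_extend step.hyps(1) u 3 by blast
    moreover have "colours \<Delta> (insert u B) \<noteq> colours \<Delta> C"
      using 3 by (auto simp: eB new_colours_eq)
    ultimately show ?thesis using above by blast
  qed
qed

text \<open>As long as the vertices of \<open>U\<close> are absorbed, the colour set stays fixed;
  the first failure, either a vertex with new colours or an absorption that splits a level, yields
  \<open>C\<close>. No colour bound is claimed for \<open>C\<close>; it has to come from the
  surroundings.\<close>

lemma homogeneous_union_saturate:
  assumes "homogeneous_union \<Delta> n B" "finite U"
  shows "homogeneous_union \<Delta> n (B \<union> U) \<and> colours \<Delta> (B \<union> U) = colours \<Delta> B \<or>
    (\<exists>C. B \<subseteq> C \<and> C \<subseteq> B \<union> U \<and> homogeneous_union \<Delta> (Suc n) C)"
  using assms(2)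
proof (induction U rule: finite_induct)
  case empty
  then show ?case using assms by simp
next
  case (insert u U)
  let ?D = "B \<union> U"
  consider "homogeneous_union \<Delta> n ?D" "colours \<Delta> ?D = colours \<Delta> B" "u \<in> ?D"
    | "homogeneous_union \<Delta> n ?D" "colours \<Delta> ?D = colours \<Delta> B" "u \<notin> ?D" "new_colours \<Delta> u ?D = {}"
    | "homogeneous_union \<Delta> n ?D" "u \<notin> ?D" "new_colours \<Delta> u ?D \<noteq> {}"
    | "\<exists>C. B \<subseteq> C \<and> C \<subseteq> ?D \<and> homogeneous_union \<Delta> (Suc n) C"
    using insert.IH by blast
  then show ?case
  proof cases
    case 1
    then show ?thesis by (simp add: insert_absorb)
  next
    case 2
    then have "colours \<Delta> (insert u ?D) = colours \<Delta> B" by (simp add: colours_insert_new)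
    then show ?thesis
      using homogeneous_union_absorb[OF 2(1,3,4)] by (auto intro!: exI[of _ "insert u ?D"])
  next
    case 3
    then show ?thesis
      using homogeneous_union_extend[OF 3] by (auto intro!: exI[of _ "insert u ?D"])
  next
    case 4
    then show ?thesis by blast
  qed
qed

text \<open>Each leaf \<open>w\<close> becomes a singleton level on top, since the edge to the
  centre \<open>v\<close> has a colour absent below. The last assumption compares \<open>w\<close>
  with all the other leaves, so the order of insertion is immaterial.\<close>

lemma homogeneous_union_star:
  assumes "homogeneous_union \<Delta> m B" "v \<in> B" "finite W" "W \<inter> B = {}"
    and "\<And>w. w \<in> W \<Longrightarrow> \<Delta> {v, w} \<notin> colours \<Delta> (B \<union> (W - {w}))"
  shows "homogeneous_union \<Delta> (m + card W) (B \<union> W)"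
  using assms(3,4,5)
proof (induction W rule: finite_induct)
  case empty
  then show ?case using assms by simp
next
  case (insert w W)
  have "\<Delta> {v, w'} \<notin> colours \<Delta> (B \<union> (W - {w'}))" if "w' \<in> W" for w'
    using insert.prems(2)[of w'] that colours_mono[of "B \<union> (W - {w'})" "B \<union> (insert w W - {w'})" \<Delta>]
    by blast
  then have "homogeneous_union \<Delta> (m + card W) (B \<union> W)"
    using insert by auto
  moreover have "w \<notin> B \<union> W" using insert by auto
  moreover have "\<Delta> {v, w} \<notin> colours \<Delta> (B \<union> W)" using insert.prems(2)[of w] insert.hyps by auto
  then have "\<Delta> {v, w} \<in> new_colours \<Delta> w (B \<union> W)"
    using assms(2) by (auto simp: new_colours_eq insert_commute)
  ultimately have "homogeneous_union \<Delta> (Suc (m + card W)) (insert w (B \<union> W))"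
    using homogeneous_union_extend by blast
  then show ?case using insert.hyps by simp
qed

section \<open>From homogeneous unions to tuples\<close>

lemma initial_union_Suc: "initial_union X (Suc n) = initial_union X n \<union> X (Suc n)"
  unfolding initial_union_def by (auto simp: atLeastAtMostSuc_conv)

lemma initial_union_cong: "(\<And>j. 1 \<le> j \<Longrightarrow> j \<le> i \<Longrightarrow> X j = Y j) \<Longrightarrow> initial_union X i = initial_union Y i"
  unfolding initial_union_def by auto

lemma homogeneous_union_imp_tuple:
  assumes "homogeneous_union \<Delta> n B" "finite (colours \<Delta> B)" "card (colours \<Delta> B) \<le> (n choose 2) + 1"
  shows "\<exists>X. homogeneous_tuple \<Delta> n X"
proof -
  \<comment> \<open>The induction carries every clause except the colour bound, which concerns the
    whole union only and need not hold for the initial unions. The part \<open>n \<ge> 1\<close>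
    ensures that appending a component at \<open>Suc n\<close> leaves \<open>X 1\<close>
    intact.\<close>
  have "n \<ge> 1 \<and> (\<exists>X. initial_union X n = B \<and> (\<forall>i\<in>{1..n}. X i \<noteq> {}) \<and>
     (\<forall>i\<in>{1..n}. \<forall>j\<in>{1..n}. i \<noteq> j \<longrightarrow> X i \<inter> X j = {}) \<and>
     (infinite (X 1) \<and> coloured \<Delta> 1 (X 1)) \<and>
     (\<forall>i\<in>{1..<n}. colours \<Delta> (initial_union X i) \<subset> colours \<Delta> (initial_union X (i + 1))) \<and>
     (\<forall>i\<in>{2..n}. \<forall>v\<in>X i. new_colours \<Delta> v (initial_union X (i - 1)) =
        colours \<Delta> (initial_union X i) - colours \<Delta> (initial_union X (i - 1))))"
    using assms(1)
  proof (induction rule: homogeneous_union.induct)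
    case (one B)
    then show ?case by (intro conjI exI[of _ "\<lambda>_. B"]) (auto simp: initial_union_def)
  next
    case (step n B C)
    then obtain X where n: "n \<ge> 1" and X: "initial_union X n = B" "\<forall>i\<in>{1..n}. X i \<noteq> {}"
      "\<forall>i\<in>{1..n}. \<forall>j\<in>{1..n}. i \<noteq> j \<longrightarrow> X i \<inter> X j = {}"
      "infinite (X 1)" "coloured \<Delta> 1 (X 1)"
      "\<forall>i\<in>{1..<n}. colours \<Delta> (initial_union X i) \<subset> colours \<Delta> (initial_union X (i + 1))"
      "\<forall>i\<in>{2..n}. \<forall>v\<in>X i. new_colours \<Delta> v (initial_union X (i - 1)) =
        colours \<Delta> (initial_union X i) - colours \<Delta> (initial_union X (i - 1))" by auto
    define Y where "Y = X(Suc n := C - B)"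
    have Yi: "Y i = X i" if "i \<le> n" for i using that by (simp add: Y_def)
    have YS: "Y (Suc n) = C - B" by (simp add: Y_def)
    have iu: "initial_union Y i = initial_union X i" if "i \<le> n" for i
      by (rule initial_union_cong) (use that Yi in auto)
    have iuS: "initial_union Y (Suc n) = C"
      using step.hyps(2) by (auto simp: initial_union_Suc iu X(1) YS)
    have sub: "X i \<subseteq> B" if "i \<in> {1..n}" for i
      using that X(1) by (auto simp: initial_union_def)
    have ne: "C - B \<noteq> {}"
      using step.hyps(2,3) by auto
    show ?case
    proof (intro conjI exI[of _ Y] ballI impI)
      show "Suc n \<ge> 1" by simp
      show "initial_union Y (Suc n) = C" by (rule iuS)
      show "Y i \<noteq> {}" if "i \<in> {1..Suc n}" for i
        using that X(2) ne by (cases "i = Suc n") (auto simp: Yi YS)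
      show "Y i \<inter> Y j = {}" if ij: "i \<in> {1..Suc n}" "j \<in> {1..Suc n}" "i \<noteq> j" for i j
      proof -
        consider "i \<in> {1..n}" "j \<in> {1..n}" | "i = Suc n" "j \<in> {1..n}" | "j = Suc n" "i \<in> {1..n}"
          using ij by (auto simp: le_Suc_eq)
        then show ?thesis
          using X(3) sub ij(3) by cases (auto simp: Yi YS)
      qed
      show "infinite (Y 1)" "coloured \<Delta> 1 (Y 1)" using X n by (auto simp: Yi)
      show "colours \<Delta> (initial_union Y i) \<subset> colours \<Delta> (initial_union Y (i + 1))"
        if "i \<in> {1..<Suc n}" for i
      proof (cases "i = n")
        case True
        then show ?thesis using step.hyps(3) by (simp add: iu iuS X(1))
      next
        case False
        then show ?thesis using that X(6) by (auto simp: iu)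
      qed
      show "new_colours \<Delta> v (initial_union Y (i - 1)) =
          colours \<Delta> (initial_union Y i) - colours \<Delta> (initial_union Y (i - 1))"
        if "i \<in> {2..Suc n}" "v \<in> Y i" for i v
      proof (cases "i = Suc n")
        case True
        then show ?thesis using step.hyps(4) that by (simp add: iu iuS X(1) YS)
      next
        case False
        then have "i \<in> {2..n}" using that by auto
        then show ?thesis using that X(7) by (auto simp: iu Yi)
      qed
    qed
  qed
  then show ?thesis using assms(2,3) unfolding homogeneous_tuple_def by auto
qed

section \<open>Colour counts and stars of private colours\<close>

text \<open>A set of t vertices has t choose 2 edges, so at most that many colours. The one further
  colour \<open>c\<close> is meant for the colour inside the infinite set.\<close>

lemma card_colours_le:
  assumes "finite T" "colours \<Delta> X \<subseteq> insert c (colours \<Delta> T)"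
  shows "card (colours \<Delta> X) \<le> (card T choose 2) + 1"
proof -
  have "card (colours \<Delta> T) \<le> card T choose 2"
    unfolding colours_def using card_image_le[of "nsets T 2" \<Delta>] assms(1)
    by (simp add: finite_imp_finite_nsets)
  moreover have fin: "finite (colours \<Delta> T)"
    unfolding colours_def using assms(1) by (simp add: finite_imp_finite_nsets)
  moreover have "card (colours \<Delta> X) \<le> card (insert c (colours \<Delta> T))"
    using fin assms(2) by (intro card_mono) auto
  ultimately show ?thesis using card_insert_le_m1[of "Suc (card T choose 2)" "colours \<Delta> T" c]
    by (simp add: card_insert_if split: if_splits)
qed

text \<open>If v has a colour other than c to A, then v is a level of its own and n - 1 leaves of its star
  suffice. Otherwise v joins A in the first level and n leaves are needed; since all vertices of F now
  send only the colour c to A, the additional vertex does not break the colour bound.\<close>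

lemma homogeneous_union_private_colours:
  assumes "infinite A" "colours \<Delta> A = {c}" "A \<inter> F = {}" "finite F"
    and d: "\<And>v a. v \<in> F \<Longrightarrow> a \<in> A \<Longrightarrow> \<Delta> {v, a} = d v"
    and "v \<in> F" "n \<ge> 1"
    and priv: "card (colours \<Delta> (A \<union> F) - colours \<Delta> (A \<union> (F - {v}))) \<ge> n"
    and v: "d v \<noteq> c \<or> (\<forall>w\<in>F. d w = c)"
  shows "\<exists>B. A \<subseteq> B \<and> B \<subseteq> A \<union> F \<and> homogeneous_union \<Delta> (Suc n) B \<and>
    card (colours \<Delta> B) \<le> (Suc n choose 2) + 1"
proof -
  define P where "P = colours \<Delta> (A \<union> F) - colours \<Delta> (A \<union> (F - {v}))"
  have finP: "finite P" using priv \<open>n \<ge> 1\<close> unfolding P_def by (intro card_ge_0_finite) linarith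
  obtain a where a: "a \<in> A" using assms(1) by fastforce
  have vA: "v \<notin> A" using assms by auto
  have cP: "c \<notin> P"
    using assms(2) colours_mono[of A "A \<union> (F - {v})" \<Delta>] unfolding P_def by auto
  \<comment> \<open>A private colour lies on an edge at \<open>v\<close>, and the edges from
    \<open>v\<close> to \<open>A\<close> all have colour \<open>d v\<close>; the other end is
    therefore in \<open>F\<close>.\<close>
  have edge: "\<exists>w\<in>F - {v}. \<Delta> {v, w} = e" if e: "e \<in> P" "e \<noteq> d v" for e
  proof -
    obtain x y where xy: "x \<in> A \<union> F" "y \<in> A \<union> F" "x \<noteq> y" "e = \<Delta> {x, y}"
      using e(1) unfolding P_def by (auto simp: colours_iff[of e \<Delta> "A \<union> F"])
    have "x = v \<or> y = v"
    proof (rule ccontr)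
      assume "\<not> ?thesis"
      then have "x \<in> A \<union> (F - {v})" "y \<in> A \<union> (F - {v})" using xy(1,2) by auto
      then have "e \<in> colours \<Delta> (A \<union> (F - {v}))" unfolding xy(4) using xy(3) by (rule edge_in_colours)
      then show False using e P_def by blast
    qed
    then obtain z where "z \<in> A \<union> F" "z \<noteq> v" "e = \<Delta> {v, z}"
      using xy by (metis insert_commute)
    then show ?thesis using d[OF \<open>v \<in> F\<close>] e by auto
  qed
  define f where "f e = (SOME w. w \<in> F - {v} \<and> \<Delta> {v, w} = e)" for e
  have f: "f e \<in> F - {v}" "\<Delta> {v, f e} = e" if "e \<in> P" "e \<noteq> d v" for e
    using someI_ex[of "\<lambda>w. w \<in> F - {v} \<and> \<Delta> {v, w} = e"] edge[OF that]
    unfolding f_def by blast+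
  have card_f: "card (f ` Q) = card Q" if "Q \<subseteq> P - {d v}" for Q
  proof (rule card_image, rule inj_onI)
    fix x y assume "x \<in> Q" "y \<in> Q" "f x = f y"
    then show "x = y" using f(2)[of x] f(2)[of y] that by auto
  qed
  \<comment> \<open>The colour \<open>e\<close> of a leaf is private, so within the set it could
    recur only at \<open>v\<close>. There it differs from \<open>d v\<close> on the edges to
    \<open>A\<close>, and the other leaves were chosen for other colours.\<close>
  have star: "homogeneous_union \<Delta> (m + card Q) (insert v A \<union> f ` Q)"
    if "homogeneous_union \<Delta> m (insert v A)" and Q: "Q \<subseteq> P - {d v}" for m Q
  proof -
    have "homogeneous_union \<Delta> (m + card (f ` Q)) (insert v A \<union> f ` Q)"
    proof (rule homogeneous_union_star[OF that(1)])
      show "v \<in> insert v A" by simp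
      show "finite (f ` Q)" using Q finP by (meson finite_Diff finite_imageI finite_subset)
      show "f ` Q \<inter> insert v A = {}" using Q f(1) assms(3) by blast
      fix w assume "w \<in> f ` Q"
      then obtain e where e: "e \<in> Q" "w = f e" by blast
      then have ew: "\<Delta> {v, w} = e" and eP: "e \<in> P" "e \<noteq> d v" using f(2) Q by auto
      let ?S = "A \<union> (f ` Q - {w})"
      have S: "?S \<subseteq> A \<union> (F - {v})" using f(1) Q by blast
      have "e \<notin> colours \<Delta> (insert v ?S)"
      proof
        assume "e \<in> colours \<Delta> (insert v ?S)"
        moreover have "e \<notin> colours \<Delta> ?S" using colours_mono[OF S] eP(1) P_def by blast
        ultimately obtain x where x: "x \<in> ?S" "e = \<Delta> {v, x}" unfolding colours_insert by blast
        show False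
        proof (cases "x \<in> A")
          case True
          then show False using d[OF \<open>v \<in> F\<close>] x eP by auto
        next
          case False
          then obtain e' where e': "e' \<in> Q" "x = f e'" "x \<noteq> w" using x by blast
          then have "e' \<in> P" "e' \<noteq> d v" using Q by auto
          then have "e' = e" using f(2) x(2) e'(2) by simp
          then show False using e' e(2) by simp
        qed
      qed
      then show "\<Delta> {v, w} \<notin> colours \<Delta> (insert v A \<union> (f ` Q - {w}))" using ew by simp
    qed
    then show ?thesis using card_f[OF Q] by simp
  qed
  have A1: "homogeneous_union \<Delta> 1 A"
    using assms by (intro one) (auto simp: coloured_def)
  have new_v: "new_colours \<Delta> v A = {d v} - {c}"
    using a d[OF \<open>v \<in> F\<close>] by (auto simp: new_colours_eq assms(2))
  have inA: "\<Delta> {x, y} = c" if "x \<in> A" "y \<in> A" "x \<noteq> y" for x y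
    using edge_in_colours[OF that, of \<Delta>] assms(2) by simp
  have colT: "colours \<Delta> (A \<union> T) \<subseteq> insert c (colours \<Delta> T \<union> d ` T)" if "T \<subseteq> F" for T
  proof
    fix e assume "e \<in> colours \<Delta> (A \<union> T)"
    then obtain x y where xy: "x \<in> A \<union> T" "y \<in> A \<union> T" "x \<noteq> y" "e = \<Delta> {x, y}"
      unfolding colours_iff by blast
    then consider "x \<in> A" "y \<in> A" | "x \<in> A" "y \<in> T" | "x \<in> T" "y \<in> A" | "x \<in> T" "y \<in> T" by blast
    then show "e \<in> insert c (colours \<Delta> T \<union> d ` T)"
    proof cases
      case 1
      then show ?thesis using xy inA by blast
    next
      case 2
      then have "e = d y" using xy(4) d[of y x] that by (auto simp: insert_commute)
      then show ?thesis using 2 by blast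
    next
      case 3
      then have "e = d x" using xy(4) d[of x y] that by auto
      then show ?thesis using 3 by blast
    next
      case 4
      then show ?thesis using edge_in_colours[of x T y \<Delta>] xy(3,4) by simp
    qed
  qed
  show ?thesis
  proof (cases "d v = c")
    case False
    then have h: "homogeneous_union \<Delta> (Suc 1) (insert v A)"
      by (intro homogeneous_union_extend A1 vA) (simp add: new_v)
    \<comment> \<open>The colour \<open>d v\<close> may itself be private, so one colour can be lost
      here; the level formed by \<open>v\<close> makes up for it.\<close>
    have "n - 1 \<le> card (P - {d v})"
      using priv[folded P_def] finP by (auto simp: card_Diff_singleton_if)
    then obtain Q where Q: "Q \<subseteq> P - {d v}" "card Q = n - 1" "finite Q"
      by (rule obtain_subset_with_card_n)
    let ?T = "insert v (f ` Q)"
    have T: "?T \<subseteq> F" using f(1) Q \<open>v \<in> F\<close> by blast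
    have "card ?T = n" using card_f[OF Q(1)] Q f(1) \<open>n \<ge> 1\<close> by (subst card_insert_disjoint) auto
    \<comment> \<open>A single vertex \<open>a\<close> stands in for all of \<open>A\<close>: its
      edges to the star show all the colours sent to \<open>A\<close>, so only \<open>c\<close> has
      to be added. This makes n + 1 vertices.\<close>
    then have "card (insert a ?T) = Suc n" using T a assms(3) Q(3)
      by (subst card_insert_disjoint) auto
    moreover have "colours \<Delta> (A \<union> ?T) \<subseteq> insert c (colours \<Delta> (insert a ?T))"
    proof -
      have "d ` ?T \<subseteq> colours \<Delta> (insert a ?T)"
      proof
        fix e assume "e \<in> d ` ?T"
        then obtain t where t: "t \<in> ?T" "e = d t" by blast
        then have tF: "t \<in> F" using T by blast
        then have "e = \<Delta> {t, a}" using d a t(2) by simp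
        moreover have "t \<noteq> a" using tF a assms(3) by blast
        ultimately show "e \<in> colours \<Delta> (insert a ?T)"
          using edge_in_colours[of t "insert a ?T" a \<Delta>] t(1) by simp
      qed
      then show ?thesis using colT[OF T] colours_mono[of ?T "insert a ?T" \<Delta>] by blast
    qed
    ultimately have "card (colours \<Delta> (A \<union> ?T)) \<le> (Suc n choose 2) + 1"
      using card_colours_le[of "insert a ?T"] Q(3) by simp
    moreover have "homogeneous_union \<Delta> (Suc n) (A \<union> ?T)"
      using star[OF h Q(1)] Q(2) \<open>n \<ge> 1\<close> by simp
    ultimately show ?thesis using T by blast
  next
    case True
    then have h: "homogeneous_union \<Delta> 1 (insert v A)"
      using assms vA new_v by (intro one) (auto simp: coloured_def colours_insert_new)
    \<comment> \<open>Since \<open>d v\<close> is \<open>c\<close>, which occurs inside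
      \<open>A\<close> and so is not private, no colour is lost.\<close>
    have "n \<le> card (P - {d v})"
      using priv[folded P_def] True cP by simp
    then obtain Q where Q: "Q \<subseteq> P - {d v}" "card Q = n" "finite Q"
      by (rule obtain_subset_with_card_n)
    let ?T = "insert v (f ` Q)"
    have T: "?T \<subseteq> F" using f(1) Q \<open>v \<in> F\<close> by blast
    have "card ?T = Suc n" using card_f[OF Q(1)] Q f(1) by (subst card_insert_disjoint) auto
    moreover have "colours \<Delta> (A \<union> ?T) \<subseteq> insert c (colours \<Delta> ?T)"
      using colT[OF T] v True T by auto
    ultimately have "card (colours \<Delta> (A \<union> ?T)) \<le> (Suc n choose 2) + 1"
      using card_colours_le[of ?T] Q(3) by (metis finite_imageI finite_insert)
    moreover have "homogeneous_union \<Delta> (Suc n) (A \<union> ?T)"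
      using star[OF h Q(1)] Q(2) by simp
    ultimately show ?thesis using T by blast
  qed
qed

section \<open>The induction on the number of levels\<close>

text \<open>The set \<open>A\<close> is fixed and \<open>F\<close> varies, as the induction
  hypothesis is applied after a vertex of \<open>F\<close> is deleted. Having \<open>A\<close>
  inside \<open>B\<close> means that only finitely many vertices remain to be added to
  \<open>B\<close>.\<close>

lemma homogeneous_union_exists:
  assumes "infinite A" "colours \<Delta> A = {c}" "A \<inter> F = {}" "finite F"
    and "\<And>v a. v \<in> F \<Longrightarrow> a \<in> A \<Longrightarrow> \<Delta> {v, a} = d v"
    and "finite (colours \<Delta> (A \<union> F))" "n \<ge> 1"
    and "card (colours \<Delta> (A \<union> F)) \<ge> (n choose 2) + 1"
  shows "\<exists>B. A \<subseteq> B \<and> B \<subseteq> A \<union> F \<and> homogeneous_union \<Delta> n B \<and>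
    card (colours \<Delta> B) \<le> (n choose 2) + 1"
  using assms(7,3-6,8)
proof (induction n arbitrary: F rule: nat_induct_at_least)
  case base
  have "homogeneous_union \<Delta> 1 A" using assms by (intro one) (auto simp: coloured_def)
  then show ?case using assms(2) by (intro exI[of _ A]) auto
next
  case (Suc n F0)
  have choose_Suc: "Suc n choose 2 = (n choose 2) + n" by (simp add: numeral_2_eq_2)
  define big where "big F \<longleftrightarrow> F \<subseteq> F0 \<and> card (colours \<Delta> (A \<union> F)) \<ge> (Suc n choose 2) + 1" for F
  have "big F0" using Suc.prems by (simp add: big_def)
  then obtain F where F: "big F" "\<And>G. big G \<Longrightarrow> card F \<le> card G"
    using ex_has_least_nat[of big F0 card] by blast
  have F0: "F \<subseteq> F0" and cardF: "card (colours \<Delta> (A \<union> F)) \<ge> (Suc n choose 2) + 1"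
    using F(1) by (auto simp: big_def)
  have finF: "finite F" and AF: "A \<inter> F = {}" using F0 Suc.prems finite_subset by blast+
  have dF: "\<And>v a. v \<in> F \<Longrightarrow> a \<in> A \<Longrightarrow> \<Delta> {v, a} = d v" using F0 Suc.prems(3) by blast
  have finc: "finite (colours \<Delta> X)" if "X \<subseteq> A \<union> F" for X
    using colours_mono[of X "A \<union> F0" \<Delta>] that F0 Suc.prems(4) finite_subset by blast
  have small: "card (colours \<Delta> (A \<union> (F - {v}))) \<le> Suc n choose 2" if "v \<in> F" for v
  proof (rule ccontr)
    assume "\<not> ?thesis"
    then have "big (F - {v})" using F0 by (auto simp: big_def)
    then show False using F(2)[of "F - {v}"] card_Diff1_less[OF finF that] by simp
  qed
  show ?case
  proof (rule ccontr)
    assume neg: "\<not> ?thesis"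
    have none: False if "A \<subseteq> B" "B \<subseteq> A \<union> F" "homogeneous_union \<Delta> (Suc n) B"
      "card (colours \<Delta> B) \<le> (Suc n choose 2) + 1" for B
      using neg that F0 by blast
    have priv: "card (colours \<Delta> (A \<union> F) - colours \<Delta> (A \<union> (F - {v}))) \<ge> n" if v: "v \<in> F" for v
    proof -
      let ?V = "A \<union> (F - {v})"
      have V: "?V \<subseteq> A \<union> F" by blast
      have "card (colours \<Delta> ?V) \<le> (n choose 2) + 1"
      \<comment> \<open>If the rest has too few colours for the induction hypothesis, the bound is
        immediate.\<close>
      proof (cases "card (colours \<Delta> ?V) \<ge> (n choose 2) + 1")
        case True
        have "\<exists>B. A \<subseteq> B \<and> B \<subseteq> ?V \<and> homogeneous_union \<Delta> n B \<and>
            card (colours \<Delta> B) \<le> (n choose 2) + 1"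
          by (rule Suc.IH) (use AF finF dF finc[OF V] True in auto)
        then obtain B where B: "A \<subseteq> B" "B \<subseteq> ?V" "homogeneous_union \<Delta> n B"
          "card (colours \<Delta> B) \<le> (n choose 2) + 1" by blast
        have BV: "B \<union> (F - {v}) = ?V" using B by blast
        \<comment> \<open>By \<open>small\<close>, any union of n + 1 levels avoiding
          \<open>v\<close> meets the colour bound automatically, contrary to \<open>none\<close>.
          Saturation therefore keeps the colours of \<open>B\<close>, and the bound for
          \<open>B\<close> passes to \<open>?V\<close>.\<close>
        have no: False if "B \<subseteq> C" "C \<subseteq> ?V" "homogeneous_union \<Delta> (Suc n) C" for C
        proof -
          have "card (colours \<Delta> C) \<le> card (colours \<Delta> ?V)"
            using colours_mono[OF that(2)] finc[OF V] by (rule card_mono[rotated])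
          then show False using none[of C] that B small[OF v] by force
        qed
        show ?thesis
          using homogeneous_union_saturate[OF B(3), of "F - {v}"] finF no B(4) unfolding BV by auto
      qed auto
      moreover have "colours \<Delta> ?V \<subseteq> colours \<Delta> (A \<union> F)" by (rule colours_mono) blast
      \<comment> \<open>The surplus is n because n + 1 choose 2 exceeds n choose 2 by n.\<close>
      ultimately show ?thesis
        using cardF choose_Suc by (simp add: card_Diff_subset finc[OF V])
    qed
    have "F \<noteq> {}" using cardF assms(2) choose_Suc Suc.hyps by auto
    \<comment> \<open>Every vertex of \<open>F\<close> has enough private colours, so
      \<open>v\<close> is free: one with \<open>d v\<close> different from \<open>c\<close> if there
      is any, otherwise an arbitrary one.\<close>
    then obtain v where v: "v \<in> F" "d v \<noteq> c \<or> (\<forall>w\<in>F. d w = c)" by blast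
    have "\<exists>B. A \<subseteq> B \<and> B \<subseteq> A \<union> F \<and> homogeneous_union \<Delta> (Suc n) B \<and>
        card (colours \<Delta> B) \<le> (Suc n choose 2) + 1"
      using assms(1,2) AF finF dF v(1) Suc.hyps priv[OF v(1)] v(2)
      by (rule homogeneous_union_private_colours)
    then show False using none by blast
  qed
qed

section \<open>Choice of the finite and the infinite set\<close>

text \<open>Pigeonhole on the vector of colours that a vertex outside \<open>F\<close> sends to
  \<open>F\<close>: only finitely many vectors exist, so one is shared by infinitely many
  vertices.\<close>

lemma infinite_subset_monochromatic_to_finite:
  fixes \<Delta> :: "nat set \<Rightarrow> nat"
  assumes "finite F" "\<And>v a. v \<in> F \<Longrightarrow> a \<notin> F \<Longrightarrow> \<Delta> {v, a} \<in> K" "finite K"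
  shows "\<exists>A d. infinite A \<and> A \<inter> F = {} \<and> (\<forall>v\<in>F. \<forall>a\<in>A. \<Delta> {v, a} = d v)"
proof -
  let ?f = "\<lambda>a. restrict (\<lambda>v. \<Delta> {v, a}) F"
  have inf: "infinite (- F)" using assms(1) by simp
  have "?f ` (- F) \<subseteq> F \<rightarrow>\<^sub>E K" using assms(2) by auto
  then have "finite (?f ` (- F))" using finite_PiE[of F "\<lambda>_. K"] assms finite_subset by blast
  then obtain a where a: "a \<in> - F" "infinite {b \<in> - F. ?f b = ?f a}"
    using pigeonhole_infinite[OF inf] by blast
  have "\<Delta> {v, b} = \<Delta> {v, a}" if "v \<in> F" "b \<in> {b \<in> - F. ?f b = ?f a}" for v b
  proof -
    have "?f b v = ?f a v" using that(2) by simp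
    then show ?thesis using that(1) by simp
  qed
  then show ?thesis
    using a by (intro exI[of _ "{b \<in> - F. ?f b = ?f a}"] exI[of _ "\<lambda>v. \<Delta> {v, a}"]) blast
qed

theorem theorem6:
  fixes \<Delta> :: "nat set \<Rightarrow> nat" and k n :: nat
  assumes "\<Delta> ` nsets UNIV 2 = {1..k}"
    and "n \<ge> 1"
    and "k \<ge> (n choose 2) + 1"
  shows "\<exists>X. homogeneous_tuple \<Delta> n X"
proof -
  have col: "colours \<Delta> UNIV = {1..k}" using assms(1) by (simp add: colours_def)
  have fin: "finite (colours \<Delta> X)" for X
    using colours_mono[of X UNIV \<Delta>] col finite_subset by fastforce
  obtain g where g: "\<And>e. e \<in> {1..k} \<Longrightarrow> g e \<in> nsets UNIV 2 \<and> \<Delta> (g e) = e"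
  proof -
    have "\<forall>e\<in>{1..k}. \<exists>x. x \<in> nsets UNIV 2 \<and> \<Delta> x = e"
      using assms(1) by (metis (no_types, lifting) imageE)
    then show ?thesis using that by metis
  qed
  \<comment> \<open>The ends of one chosen edge for each colour.\<close>
  define F where "F = (\<Union>e\<in>{1..k}. g e)"
  have finF: "finite F" using g by (force simp: F_def nsets_def)
  have Fcol: "{1..k} \<subseteq> colours \<Delta> F"
  proof
    fix e assume e: "e \<in> {1..k}"
    then have "g e \<in> nsets F 2" using g[OF e] by (auto simp: F_def nsets_def)
    then show "e \<in> colours \<Delta> F" using g[OF e] by (force simp: colours_def)
  qed
  have "\<Delta> {v, a} \<in> {1..k}" if "v \<in> F" "a \<notin> F" for v a
    using edge_in_colours[of v UNIV a \<Delta>] that col by auto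
  then obtain A0 d where A0: "infinite A0" "A0 \<inter> F = {}" "\<forall>v\<in>F. \<forall>a\<in>A0. \<Delta> {v, a} = d v"
    using infinite_subset_monochromatic_to_finite[OF finF _ finite_atLeastAtMost, of \<Delta> 1 k] by blast
  \<comment> \<open>Ramsey's theorem is applied with the colours below \<open>Suc k\<close>, as the
    given ones run from 1 to \<open>k\<close>. Passing to a subset of \<open>A0\<close> preserves
    the constant colours towards \<open>F\<close>.\<close>
  have "\<Delta> {x, y} < Suc k" if "x \<noteq> y" for x y
    using edge_in_colours[of x UNIV y \<Delta>] that col by auto
  then obtain A c where A: "A \<subseteq> A0" "infinite A" "\<forall>x\<in>A. \<forall>y\<in>A. x \<noteq> y \<longrightarrow> \<Delta> {x, y} = c"
    using Ramsey2[OF A0(1), of \<Delta> "Suc k"] by blast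
  have "colours \<Delta> A = {c}"
  proof
    show "colours \<Delta> A \<subseteq> {c}" using A(3) by (auto simp: colours_iff)
    obtain x where x: "x \<in> A" using A(2) by fastforce
    obtain y where "y \<in> A - {x}"
      using infinite_imp_nonempty[OF infinite_remove[OF A(2)]] by blast
    then show "{c} \<subseteq> colours \<Delta> A" using A(3) x edge_in_colours[of x A y \<Delta>] by auto
  qed
  moreover have "(n choose 2) + 1 \<le> card (colours \<Delta> (A \<union> F))"
    using card_mono[OF fin, of "{1..k}"] Fcol colours_mono[of F "A \<union> F" \<Delta>] assms(3) by fastforce
  ultimately obtain B where "homogeneous_union \<Delta> n B" "card (colours \<Delta> B) \<le> (n choose 2) + 1"
    using homogeneous_union_exists[of A \<Delta> c F d n] A A0 finF fin assms(2) by blast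
  then show ?thesis using homogeneous_union_imp_tuple fin by blast
qed

end
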